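(* Let $\alpha \in \mathbb{H}$ and let $(X_i)_{i\ge 1}$ be i.i.d. real-valued continuous random variables such that $E[|X_1|^{\beta}] < +\infty$ for some $\beta > 0$. For $n \ge 1$ let \[ C_n^{(\alpha)} := \frac{\sum_{j=1}^{n} X_j/(X_j + \alpha)}{\sum_{j=1}^{n} 1/(X_j + \alpha)}, \qquad \mu^{(\alpha)} := E\left[\frac{1}{X_1+\alpha}\right]. \] Then \[ \lim_{n \to \infty} n\, \mathrm{Var}\left(C_n^{(\alpha)}\right) = \frac{1}{\left|\mu^{(\alpha)}\right|^4} \mathrm{Var}\left(\frac{1}{X_1 + \alpha}\right). \]
   Context: $\mathbb{H} = \{x+yi : x\in\mathbb{R},\, y>0\}$. A real-valued random variable $X$ is called continuous if $P(X=x)=0$ for every $x \in \mathbb{R}$. For a complex-valued random variable $Y$, $E[Y] := E[\mathrm{Re}(Y)] + iE[\mathrm{Im}(Y)]$ and $\mathrm{Var}(Y) := E[|Y - E[Y]|^2]$. *)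

theory Defs
  imports "HOL-Probability.Probability"
begin

definition upper_half_plane :: "complex set" where
  "upper_half_plane = {z. Im z > 0}"

definition complex_expectation :: "'a measure \<Rightarrow> ('a \<Rightarrow> complex) \<Rightarrow> complex" where
  "complex_expectation M Y =
     Complex (\<integral>\<omega>. Re (Y \<omega>) \<partial>M) (\<integral>\<omega>. Im (Y \<omega>) \<partial>M)"

text \<open>
  The outer expectation is that of a nonnegative random variable, hence valued in
  \<open>[0, \<infinity>]\<close>. On a probability space the value is \<open>\<infinity>\<close> exactly when a random variable
  \<open>Y\<close> is not square-integrable (lemma \<open>complex_variance_finite_iff\<close>). In particular
  the value 0 that the Bochner integral gives to non-integrable functions cannot
  make the variance finite.
\<close>

definition complex_variance :: "'a measure \<Rightarrow> ('a \<Rightarrow> complex) \<Rightarrow> ennreal" where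
  "complex_variance M Y =
     (\<integral>\<^sup>+\<omega>. ennreal ((cmod (Y \<omega> - complex_expectation M Y))\<^sup>2) \<partial>M)"

text \<open>
  For \<open>\<alpha>\<close> in the upper half-plane and real \<open>X\<close>, every \<open>1 / (X + \<alpha>)\<close> has negative
  imaginary part, so no division by zero occurs for \<open>n \<ge> 1\<close>.
\<close>

definition C_stat :: "complex \<Rightarrow> (nat \<Rightarrow> 'a \<Rightarrow> real) \<Rightarrow> nat \<Rightarrow> 'a \<Rightarrow> complex" where
  "C_stat \<alpha> X n \<omega> =
     (\<Sum>j=1..n. complex_of_real (X j \<omega>) / (complex_of_real (X j \<omega>) + \<alpha>)) /
     (\<Sum>j=1..n. 1 / (complex_of_real (X j \<omega>) + \<alpha>))"

lemma complex_expectation_eq_integral: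
  assumes "integrable M Y"
  shows "complex_expectation M Y = (\<integral>\<omega>. Y \<omega> \<partial>M)"
  using assms by (simp add: complex_expectation_def complex_eq_iff)

lemma (in prob_space) square_integrable_shift:
  fixes Y :: "'a \<Rightarrow> complex"
  assumes [measurable]: "Y \<in> borel_measurable M"
    and int: "integrable M (\<lambda>\<omega>. (cmod (Y \<omega>))\<^sup>2)"
  shows "integrable M (\<lambda>\<omega>. (cmod (Y \<omega> - c))\<^sup>2)"
proof (rule Bochner_Integration.integrable_bound)
  show "integrable M (\<lambda>\<omega>. 2 * (cmod (Y \<omega>))\<^sup>2 + 2 * (cmod c)\<^sup>2)"
    using int by simp
  have "(cmod (y - c))\<^sup>2 \<le> 2 * (cmod y)\<^sup>2 + 2 * (cmod c)\<^sup>2" for y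
  proof -
    have "(cmod (y - c))\<^sup>2 \<le> (cmod y + cmod c)\<^sup>2"
      by (intro power_mono norm_triangle_ineq4) auto
    also have "\<dots> \<le> 2 * (cmod y)\<^sup>2 + 2 * (cmod c)\<^sup>2"
      using zero_le_power2[of "cmod y - cmod c"] by (simp add: power2_eq_square algebra_simps)
    finally show ?thesis .
  qed
  then show "AE \<omega> in M. norm ((cmod (Y \<omega> - c))\<^sup>2) \<le> norm (2 * (cmod (Y \<omega>))\<^sup>2 + 2 * (cmod c)\<^sup>2)"
    by (intro AE_I2) simp
qed measurable

lemma (in prob_space) complex_variance_finite_iff:
  assumes [measurable]: "Y \<in> borel_measurable M"
  shows "complex_variance M Y < \<infinity> \<longleftrightarrow> integrable M (\<lambda>\<omega>. (cmod (Y \<omega>))\<^sup>2)"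
proof -
  let ?c = "complex_expectation M Y"
  have "complex_variance M Y < \<infinity> \<longleftrightarrow> integrable M (\<lambda>\<omega>. (cmod (Y \<omega> - ?c))\<^sup>2)"
    by (simp add: complex_variance_def integrable_iff_bounded)
  also have "\<dots> \<longleftrightarrow> integrable M (\<lambda>\<omega>. (cmod (Y \<omega>))\<^sup>2)"
    using square_integrable_shift[of Y ?c] square_integrable_shift[of "\<lambda>\<omega>. Y \<omega> - ?c" "- ?c"]
    by auto
  finally show ?thesis .
qed

lemma (in prob_space) complex_variance_eq_integral:
  assumes "Y \<in> borel_measurable M" "integrable M (\<lambda>\<omega>. (cmod (Y \<omega>))\<^sup>2)"
  shows "complex_variance M Y =
    ennreal (\<integral>\<omega>. (cmod (Y \<omega> - complex_expectation M Y))\<^sup>2 \<partial>M)"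
  unfolding complex_variance_def
  by (rule nn_integral_eq_integral) (use square_integrable_shift[OF assms] in auto)

end

theory Submission
  imports Defs "HOL-Real_Asymp.Real_Asymp"
begin

text \<open>
  With \<open>Z\<^sub>j = 1 / (X\<^sub>j + \<alpha>)\<close> one has \<open>C\<^sub>n + \<alpha> = 1 / (\<mu> + W\<^sub>n)\<close>, where \<open>\<mu> + W\<^sub>n\<close> is the mean of the
  bounded variables \<open>Z\<^sub>1, \<dots>, Z\<^sub>n\<close>. Expanding the inverse to first order around \<open>\<mu>\<close> leaves the remainder
  \<open>R\<^sub>n = W\<^sub>n\<^sup>2 / (\<mu>\<^sup>2 (\<mu> + W\<^sub>n))\<close>, and the claim amounts to \<open>n E|R\<^sub>n|\<^sup>2 \<longlonglongrightarrow> 0\<close>. Where \<open>W\<^sub>n\<close> is small,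
  \<open>|R\<^sub>n|\<^sup>2\<close> is a small multiple of \<open>|W\<^sub>n|\<^sup>2\<close>; the complement has exponentially small probability by
  Hoeffding's inequality, so there a uniform bound on \<open>E|\<mu> + W\<^sub>n|\<^sup>-\<^sup>4\<close> suffices. That bound comes from
  \<open>|\<mu> + W\<^sub>n| \<ge> mean (- Im Z\<^sub>j)\<close>: replacing the arithmetic mean by the geometric one makes the
  negative moment factor, and for large \<open>n\<close> each factor only needs the moment of order \<open>\<beta>\<close> of \<open>X\<^sub>1\<close>.
\<close>

section \<open>Deterministic estimates\<close>

text \<open>Serves double limits in which n tends to infinity first, with \<eta> fixed, and \<eta>
  tends to 0 afterwards. For fixed n the bound may blow up as \<eta> shrinks, since each tolerance
  needs only one small \<eta>.\<close>

lemma tendsto_zero_of_family_bound: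
  fixes f :: "nat \<Rightarrow> real" and u :: "real \<Rightarrow> nat \<Rightarrow> real"
  assumes "\<forall>\<^sub>F \<eta> in at_right 0. \<forall>\<^sub>F n in sequentially. \<bar>f n\<bar> \<le> u \<eta> n"
    and "\<And>\<eta>. \<eta> > 0 \<Longrightarrow> u \<eta> \<longlonglongrightarrow> L \<eta>"
    and "(L \<longlongrightarrow> 0) (at_right 0)"
  shows "f \<longlonglongrightarrow> 0"
proof (rule tendstoI)
  fix e :: real assume "e > 0"
  with assms(3) have "\<forall>\<^sub>F \<eta> in at_right 0. L \<eta> < e"
    by (rule order_tendstoD)
  with assms(1) eventually_at_right_less[of 0]
  have "\<forall>\<^sub>F \<eta> in at_right 0. (\<forall>\<^sub>F n in sequentially. \<bar>f n\<bar> \<le> u \<eta> n) \<and> L \<eta> < e \<and> \<eta> > 0"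
    by eventually_elim auto
  then obtain \<eta> where \<eta>: "\<forall>\<^sub>F n in sequentially. \<bar>f n\<bar> \<le> u \<eta> n" "L \<eta> < e" "\<eta> > 0"
    by (metis (mono_tags, lifting) eventually_happens trivial_limit_at_right_real)
  have "\<forall>\<^sub>F n in sequentially. u \<eta> n < e"
    using assms(2)[OF \<eta>(3)] \<eta>(2) by (rule order_tendstoD)
  with \<eta>(1) show "\<forall>\<^sub>F n in sequentially. dist (f n) 0 < e"
    by eventually_elim (simp add: dist_real_def)
qed

text \<open>AM-GM bounds the negative power of the mean by the product of the
  \<open>y j powr (- (p / n))\<close>. As p / n is at most s, each factor is then controlled by the
  power of order -s, however large p is. The product form lets independence factor the expectation
  later.\<close>

lemma inverse_mean_powr_le_prod:
  fixes y :: "nat \<Rightarrow> real"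
  assumes pos: "\<And>j. j \<in> {1..n} \<Longrightarrow> y j > 0" and "n \<ge> 1" "p > 0" "s > 0" "p \<le> s * n"
  shows "(n / (\<Sum>j=1..n. y j)) powr p \<le> (\<Prod>j=1..n. 1 + p / (s * n) * y j powr (- s))"
proof -
  \<comment> \<open>The exponent p / n is the fraction \<theta> of s; \<open>p \<le> s * n\<close>
    makes \<theta> an admissible convex weight.\<close>
  define \<theta> where "\<theta> = p / (s * n)"
  have \<theta>: "0 \<le> \<theta>" "\<theta> \<le> 1" "s * \<theta> = p / n"
    using assms by (auto simp: \<theta>_def field_simps)
  have sum: "(\<Sum>j=1..n. y j) > 0"
    using assms by (intro sum_pos) auto
  have prod: "(\<Prod>j=1..n. y j) > 0"
    using pos by (intro prod_pos) auto
  have "(\<Prod>j=1..n. y j) powr (1 / n) \<le> (\<Sum>j=1..n. y j) / n"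
    using arith_geom_mean[of "{1..n}" y] assms by (simp add: sum_divide_distrib less_imp_le)
  then have "((\<Sum>j=1..n. y j) / n) powr (- p) \<le> ((\<Prod>j=1..n. y j) powr (1 / n)) powr (- p)"
    using prod assms(3) by (intro powr_mono2') (simp_all del: prod_zero_iff)
  also have "((\<Sum>j=1..n. y j) / n) powr (- p) = (n / (\<Sum>j=1..n. y j)) powr p"
    using sum assms by (simp add: powr_minus powr_divide)
  also have "((\<Prod>j=1..n. y j) powr (1 / n)) powr (- p) = (\<Prod>j=1..n. y j powr (- (p / n)))"
    using pos by (subst prod_powr_distrib[symmetric]) (auto simp: powr_powr less_imp_le)
  also have "\<dots> \<le> (\<Prod>j=1..n. 1 + \<theta> * y j powr (- s))"
  proof (intro prod_mono conjI)
    fix j assume j: "j \<in> {1..n}"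
    \<comment> \<open>Young's inequality with weights \<theta> and 1 - \<theta> compares
      \<open>y j powr (- s)\<close> with 1.\<close>
    have "y j powr (- (p / n)) = (y j powr (- s)) powr \<theta> * 1 powr (1 - \<theta>)"
      using \<theta> by (simp add: powr_powr)
    also have "\<dots> \<le> \<theta> * y j powr (- s) + (1 - \<theta>) * 1"
      using \<theta> pos[OF j] by (intro Youngs_inequality_0) auto
    finally show "y j powr (- (p / n)) \<le> 1 + \<theta> * y j powr (- s)"
      using \<theta> by simp
  qed auto
  finally show ?thesis
    by (simp add: \<theta>_def)
qed

text \<open>The cross term \<open>2 * inner a b\<close> is split by weighted AM-GM. A small \<eta>
  keeps the error relative to the main part a small, at the price of a large factor on b, which is
  affordable when b is of smaller order.\<close>

lemma abs_norm_add_square_diff_le: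
  fixes a b :: "'a::real_inner" and \<eta> :: real
  assumes "\<eta> > 0"
  shows "\<bar>(norm (a + b))\<^sup>2 - (norm a)\<^sup>2\<bar> \<le> \<eta> * (norm a)\<^sup>2 + (1 + 1 / \<eta>) * (norm b)\<^sup>2"
proof -
  have "2 * \<bar>inner a b\<bar> \<le> 2 * (norm a * norm b)"
    using Cauchy_Schwarz_ineq2[of a b] by simp
  also have "\<dots> \<le> \<eta> * (norm a)\<^sup>2 + (norm b)\<^sup>2 / \<eta>"
  proof -
    have "0 \<le> (\<eta> * norm a - norm b)\<^sup>2 / \<eta>"
      using assms by simp
    also have "\<dots> = \<eta> * (norm a)\<^sup>2 + (norm b)\<^sup>2 / \<eta> - 2 * (norm a * norm b)"
      using assms by (simp add: power2_eq_square field_simps)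
    finally show ?thesis by simp
  qed
  moreover have "(norm (a + b))\<^sup>2 - (norm a)\<^sup>2 = 2 * inner a b + (norm b)\<^sup>2"
    by (simp add: power2_norm_eq_inner inner_add inner_commute)
  moreover have "(norm b)\<^sup>2 \<ge> 0" by simp
  moreover have "(1 + 1 / \<eta>) * (norm b)\<^sup>2 = (norm b)\<^sup>2 + (norm b)\<^sup>2 / \<eta>"
    by (simp add: algebra_simps)
  ultimately show ?thesis
    by linarith
qed

text \<open>If \<open>cmod w < \<epsilon>\<close>, the denominator stays at distance at least
  \<open>cmod \<mu> / 2\<close> from 0, which gives the first summand; otherwise
  \<open>cmod w\<close> is bounded by B and the inverse is kept. The summands are shaped for
  expectations: a second moment, an inverse fourth moment and a tail probability.\<close>

lemma inverse_Taylor_remainder_bound: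
  fixes w \<mu> :: complex and n :: nat
  assumes "\<mu> \<noteq> 0" "\<mu> + w \<noteq> 0" "cmod w \<le> B" "0 < \<epsilon>" "\<epsilon> \<le> cmod \<mu> / 2" "n > 0"
  shows "(cmod (1 / (\<mu> + w) - 1 / \<mu> + w / \<mu>\<^sup>2))\<^sup>2 \<le>
    4 * \<epsilon>\<^sup>2 / cmod \<mu> ^ 6 * (cmod w)\<^sup>2 +
    B ^ 4 / cmod \<mu> ^ 4 * (cmod (1 / (\<mu> + w)) ^ 4 / n\<^sup>2 + n\<^sup>2 * of_bool (cmod w \<ge> \<epsilon>))"
proof -
  have "1 / (\<mu> + w) - 1 / \<mu> + w / \<mu>\<^sup>2 = w\<^sup>2 / \<mu>\<^sup>2 * (1 / (\<mu> + w))"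
  proof -
    \<comment> \<open>With t as the variable the denominator becomes atomic, so that fractions can
      be cleared.\<close>
    define t where "t = \<mu> + w"
    have w: "w = t - \<mu>" and "t \<noteq> 0" using assms(2) by (simp_all add: t_def)
    then show ?thesis
      using assms(1) unfolding w by (simp add: field_simps power2_eq_square)
  qed
  then have eq: "(cmod (1 / (\<mu> + w) - 1 / \<mu> + w / \<mu>\<^sup>2))\<^sup>2 =
      cmod w ^ 4 / cmod \<mu> ^ 4 * (cmod (1 / (\<mu> + w)))\<^sup>2"
    by (simp add: norm_mult norm_divide norm_power power_mult_distrib power_divide)
  have \<mu>: "cmod \<mu> > 0" using assms by simp
  show ?thesis
  proof (cases "cmod w \<ge> \<epsilon>")
    case False
    have "cmod \<mu> \<le> cmod (\<mu> + w) + cmod w"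
      using norm_triangle_ineq4[of "\<mu> + w" w] by simp
    then have "cmod \<mu> / 2 \<le> cmod (\<mu> + w)"
      using False assms by linarith
    then have "1 / cmod (\<mu> + w) \<le> 1 / (cmod \<mu> / 2)"
      using \<mu> by (intro frac_le) auto
    then have "(cmod (1 / (\<mu> + w)))\<^sup>2 \<le> (2 / cmod \<mu>)\<^sup>2"
      by (intro power_mono) (auto simp: norm_divide)
    \<comment> \<open>Only two of the four factors \<open>cmod w\<close> are traded for \<epsilon>;
      the other two are kept because n times the second moment of \<open>W n\<close> is constant in
      the application.\<close>
    moreover have "cmod w ^ 4 \<le> \<epsilon>\<^sup>2 * (cmod w)\<^sup>2"
    proof -
      have "(cmod w)\<^sup>2 * (cmod w)\<^sup>2 \<le> \<epsilon>\<^sup>2 * (cmod w)\<^sup>2"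
        using False by (intro mult_right_mono power_mono) auto
      then show ?thesis by (simp flip: power_add)
    qed
    ultimately have "cmod w ^ 4 / cmod \<mu> ^ 4 * (cmod (1 / (\<mu> + w)))\<^sup>2 \<le>
        (\<epsilon>\<^sup>2 * (cmod w)\<^sup>2) / cmod \<mu> ^ 4 * (2 / cmod \<mu>)\<^sup>2"
      by (intro mult_mono divide_right_mono) auto
    also have "\<dots> = 4 * \<epsilon>\<^sup>2 / cmod \<mu> ^ 6 * (cmod w)\<^sup>2"
      using \<mu> by (simp add: field_simps eval_nat_numeral)
    also have "\<dots> \<le> 4 * \<epsilon>\<^sup>2 / cmod \<mu> ^ 6 * (cmod w)\<^sup>2 +
      B ^ 4 / cmod \<mu> ^ 4 * (cmod (1 / (\<mu> + w)) ^ 4 / n\<^sup>2 + n\<^sup>2 * of_bool (cmod w \<ge> \<epsilon>))"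
      by simp
    finally show ?thesis unfolding eq .
  next
    case True
    let ?v = "(cmod (1 / (\<mu> + w)))\<^sup>2"
    txt \<open>AM-GM; the weight \<open>n\<close> is chosen so that the fourth moment, multiplied by \<open>n\<close>, still vanishes.\<close>
    have "?v \<le> 2 * (?v / n) * n"
      using \<open>n > 0\<close> by simp
    also have "\<dots> \<le> (?v / n)\<^sup>2 + (real n)\<^sup>2"
      by (rule sum_squares_bound)
    also have "\<dots> = cmod (1 / (\<mu> + w)) ^ 4 / n\<^sup>2 + n\<^sup>2 * of_bool (cmod w \<ge> \<epsilon>)"
      using True by (simp add: power_divide flip: power_mult)
    finally have v: "?v \<le> \<dots>" .
    have "cmod w ^ 4 / cmod \<mu> ^ 4 * ?v \<le>
      B ^ 4 / cmod \<mu> ^ 4 * (cmod (1 / (\<mu> + w)) ^ 4 / n\<^sup>2 + n\<^sup>2 * of_bool (cmod w \<ge> \<epsilon>))"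
      using assms by (intro mult_mono v divide_right_mono power_mono) auto
    also have "\<dots> \<le> 4 * \<epsilon>\<^sup>2 / cmod \<mu> ^ 6 * (cmod w)\<^sup>2 + \<dots>"
      by simp
    finally show ?thesis unfolding eq .
  qed
qed

section \<open>Moments and deviations of independent sums\<close>

context prob_space
begin

text \<open>Bienayme's identity for centred variables: \<open>Y i\<close> is independent of the
  remaining sum, so the cross term has expectation zero. Integrability is carried through the
  induction because linearity of the integral needs it.\<close>

lemma indep_vars_expectation_sum_square:
  fixes Y :: "'i \<Rightarrow> 'a \<Rightarrow> real"
  assumes "finite I" "indep_vars (\<lambda>_. borel) Y I"
    and "\<And>i. i \<in> I \<Longrightarrow> integrable M (\<lambda>\<omega>. (Y i \<omega>)\<^sup>2)"
    and "\<And>i. i \<in> I \<Longrightarrow> expectation (Y i) = 0"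
  shows "integrable M (\<lambda>\<omega>. (\<Sum>i\<in>I. Y i \<omega>)\<^sup>2) \<and>
    expectation (\<lambda>\<omega>. (\<Sum>i\<in>I. Y i \<omega>)\<^sup>2) = (\<Sum>i\<in>I. expectation (\<lambda>\<omega>. (Y i \<omega>)\<^sup>2))"
  using assms
proof (induction I rule: finite_induct)
  case empty
  then show ?case by simp
next
  case (insert i I)
  let ?S = "\<lambda>\<omega>. \<Sum>j\<in>I. Y j \<omega>"
  have rv: "random_variable borel (Y j)" if "j \<in> insert i I" for j
    using insert.prems(1) that by (auto simp: indep_vars_def)
  have int: "integrable M (Y j)" if "j \<in> insert i I" for j
    using rv[OF that] insert.prems(2)[OF that] by (rule square_integrable_imp_integrable)
  have IH: "integrable M (\<lambda>\<omega>. (?S \<omega>)\<^sup>2)"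
    "expectation (\<lambda>\<omega>. (?S \<omega>)\<^sup>2) = (\<Sum>j\<in>I. expectation (\<lambda>\<omega>. (Y j \<omega>)\<^sup>2))"
    using insert.IH[OF indep_vars_subset[OF insert.prems(1)]] insert.prems by auto
  have indep: "indep_var borel (Y i) borel ?S"
    using insert by (intro indep_vars_sum) auto
  have intS: "integrable M ?S"
    using int by auto
  have prod: "integrable M (\<lambda>\<omega>. Y i \<omega> * ?S \<omega>)" "expectation (\<lambda>\<omega>. Y i \<omega> * ?S \<omega>) = 0"
    using indep_var_integrable[OF indep int intS] indep_var_lebesgue_integral[OF indep int intS]
      insert.prems(3) by auto
  have eq: "(\<Sum>j\<in>insert i I. Y j \<omega>)\<^sup>2 = (Y i \<omega>)\<^sup>2 + 2 * (Y i \<omega> * ?S \<omega>) + (?S \<omega>)\<^sup>2" for \<omega>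
    using insert.hyps by (simp add: power2_sum)
  show ?case
    unfolding eq using insert.hyps insert.prems(2) IH prod by simp
qed

lemma
  fixes g :: "real \<Rightarrow> 'b::{banach, second_countable_topology}"
  assumes "distr M borel X = distr M borel Y" "random_variable borel X" "random_variable borel Y"
    and "g \<in> borel_measurable borel"
  shows expectation_cong_distr: "expectation (\<lambda>\<omega>. g (X \<omega>)) = expectation (\<lambda>\<omega>. g (Y \<omega>))"
    and integrable_cong_distr: "integrable M (\<lambda>\<omega>. g (X \<omega>)) \<longleftrightarrow> integrable M (\<lambda>\<omega>. g (Y \<omega>))"
  using assms integral_distr[of X M borel g] integral_distr[of Y M borel g]
    integrable_distr_eq[of X M borel g] integrable_distr_eq[of Y M borel g] by auto

text \<open>Independence turns the product bound of \<open>inverse_mean_powr_le_prod\<close> into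
  \<open>(1 + \<theta> * m) ^ n\<close> with \<theta> proportional to 1 / n, which an exponential
  free of n dominates. Thus a single negative moment of arbitrarily small order s controls the
  inverse mean to any order p.\<close>

lemma inverse_mean_moment_bound:
  fixes Y :: "nat \<Rightarrow> 'a \<Rightarrow> real"
  assumes indep: "indep_vars (\<lambda>_. borel) Y {1..}"
    and distr: "\<And>i. i \<ge> 1 \<Longrightarrow> distr M borel (Y i) = distr M borel (Y 1)"
    and pos: "\<And>i \<omega>. Y i \<omega> > 0"
    and s: "s > 0" and int: "integrable M (\<lambda>\<omega>. Y 1 \<omega> powr (- s))"
    and p: "p > 0"
  shows "\<exists>K. \<forall>\<^sub>F n in sequentially.
    integrable M (\<lambda>\<omega>. (n / (\<Sum>j=1..n. Y j \<omega>)) powr p) \<and>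
    expectation (\<lambda>\<omega>. (n / (\<Sum>j=1..n. Y j \<omega>)) powr p) \<le> K"
proof -
  define m where "m = expectation (\<lambda>\<omega>. Y 1 \<omega> powr (- s))"
  have m: "m \<ge> 0"
    unfolding m_def by (intro integral_nonneg_AE) auto
  have rv: "random_variable borel (Y i)" if "i \<ge> 1" for i
    using indep that by (auto simp: indep_vars_def)
  have int_i: "integrable M (\<lambda>\<omega>. Y i \<omega> powr (- s))"
    and exp_i: "expectation (\<lambda>\<omega>. Y i \<omega> powr (- s)) = m" if "i \<ge> 1" for i
    using integrable_cong_distr[OF distr[OF that] rv[OF that] rv[of 1], of "\<lambda>x. x powr (- s)"]
      expectation_cong_distr[OF distr[OF that] rv[OF that] rv[of 1], of "\<lambda>x. x powr (- s)"] int
    by (auto simp: m_def)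
  have main: "integrable M (\<lambda>\<omega>. (n / (\<Sum>j=1..n. Y j \<omega>)) powr p) \<and>
    expectation (\<lambda>\<omega>. (n / (\<Sum>j=1..n. Y j \<omega>)) powr p) \<le> exp (p * m / s)"
    if n: "n \<ge> 1" "p \<le> s * n" for n :: nat
  proof -
    define \<theta> where "\<theta> = p / (s * n)"
    have \<theta>: "\<theta> \<ge> 0" "n * \<theta> = p / s"
      using p s n by (auto simp: \<theta>_def)
    let ?D = "\<lambda>j \<omega>. 1 + \<theta> * Y j \<omega> powr (- s)"
    have le: "(n / (\<Sum>j=1..n. Y j \<omega>)) powr p \<le> (\<Prod>j=1..n. ?D j \<omega>)" for \<omega>
      unfolding \<theta>_def by (rule inverse_mean_powr_le_prod) (use pos n p s in auto)
    have indep_D: "indep_vars (\<lambda>_. borel) ?D {1..n}"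
      by (rule indep_vars_compose2[OF indep_vars_subset[OF indep]]) auto
    have int_D: "integrable M (?D j)" and exp_D: "expectation (?D j) = 1 + \<theta> * m"
      if "j \<in> {1..n}" for j
      using that int_i exp_i by (auto simp: prob_space)
    have D: "integrable M (\<lambda>\<omega>. \<Prod>j=1..n. ?D j \<omega>)"
      "expectation (\<lambda>\<omega>. \<Prod>j=1..n. ?D j \<omega>) = (1 + \<theta> * m) ^ n"
      using indep_vars_integrable[OF _ indep_D int_D] indep_vars_lebesgue_integral[OF _ indep_D int_D]
        exp_D by simp_all
    have meas: "(\<lambda>\<omega>. (n / (\<Sum>j=1..n. Y j \<omega>)) powr p) \<in> borel_measurable M"
      using rv by measurable
    have int_n: "integrable M (\<lambda>\<omega>. (n / (\<Sum>j=1..n. Y j \<omega>)) powr p)"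
      by (rule Bochner_Integration.integrable_bound[OF D(1) meas])
        (intro AE_I2, use order.trans[OF le abs_ge_self] in simp)
    have "expectation (\<lambda>\<omega>. (n / (\<Sum>j=1..n. Y j \<omega>)) powr p) \<le> (1 + \<theta> * m) ^ n"
      unfolding D(2)[symmetric] by (rule integral_mono[OF int_n D(1) le])
    \<comment> \<open>Since \<open>n * \<theta> = p / s\<close>, the n-th power of this exponential
      no longer depends on n.\<close>
    also have "\<dots> \<le> exp (\<theta> * m) ^ n"
      using \<theta> m by (intro power_mono exp_ge_add_one_self) auto
    also have "\<dots> = exp (p * m / s)"
      using \<theta>(2) by (simp add: exp_of_nat_mult[symmetric] mult.assoc[symmetric])
    finally show ?thesis
      using int_n by simp
  qed
  have "\<forall>\<^sub>F n in sequentially. n \<ge> 1 \<and> p \<le> s * real n"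
    using eventually_ge_at_top[of "nat \<lceil>p / s\<rceil>"] eventually_ge_at_top[of 1]
  proof eventually_elim
    case (elim n)
    then have "p / s \<le> n" by linarith
    with s elim show ?case by (simp add: field_simps)
  qed
  then show ?thesis
    by (intro exI[of _ "exp (p * m / s)"]) (rule eventually_mono, assumption, rule main, auto)
qed

text \<open>A complex deviation of size \<epsilon> forces a deviation of at least \<epsilon> / 2 in
  the real or the imaginary part. Two two-sided real Hoeffding bounds then give the factor
  4.\<close>

lemma Hoeffding_mean_complex:
  fixes Z :: "nat \<Rightarrow> 'a \<Rightarrow> complex"
  assumes indep: "indep_vars (\<lambda>_. borel) Z {1..}"
    and mean: "\<And>i. i \<ge> 1 \<Longrightarrow> expectation (Z i) = \<mu>"
    and bound: "\<And>i \<omega>. cmod (Z i \<omega>) \<le> B" and "B > 0" "\<epsilon> > 0" "n \<ge> 1"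
  shows "prob {\<omega>\<in>space M. cmod ((\<Sum>j=1..n. Z j \<omega>) / n - \<mu>) \<ge> \<epsilon>} \<le>
    4 * exp (- (\<epsilon>\<^sup>2 / (8 * B\<^sup>2)) * n)"
proof -
  have rv: "random_variable borel (Z i)" if "i \<ge> 1" for i
    using indep that by (auto simp: indep_vars_def)
  have int: "integrable M (Z i)" if "i \<ge> 1" for i
    by (rule integrable_const_bound[of _ B]) (use rv that bound in auto)
  \<comment> \<open>A general functional f covers \<open>Re\<close> and \<open>Im\<close> by one
    argument.\<close>
  have *: "prob {\<omega>\<in>space M. \<bar>(\<Sum>j=1..n. f (Z j \<omega>)) - n * f \<mu>\<bar> \<ge> \<epsilon> / 2 * n} \<le>
      2 * exp (- (\<epsilon>\<^sup>2 / (8 * B\<^sup>2)) * n)"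
    if f: "bounded_linear f" "\<And>z. \<bar>f z\<bar> \<le> cmod z" for f :: "complex \<Rightarrow> real"
  proof -
    have [measurable]: "f \<in> borel_measurable borel"
      by (intro borel_measurable_continuous_onI linear_continuous_on f)
    have Ef: "expectation (\<lambda>\<omega>. f (Z i \<omega>)) = f \<mu>" if "i \<ge> 1" for i
      using integral_bounded_linear[OF f(1) int[OF that]] mean[OF that] by simp
    interpret Hoeffding_ineq M "{1..n}" "\<lambda>i \<omega>. f (Z i \<omega>)" "\<lambda>_. - B" "\<lambda>_. B" "n * f \<mu>"
    proof unfold_locales
      show "indep_vars (\<lambda>_. borel) (\<lambda>i \<omega>. f (Z i \<omega>)) {1..n}"
        by (rule indep_vars_compose2[OF indep_vars_subset[OF indep]]) auto
      show "AE x in M. f (Z i x) \<in> {- B..B}" for i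
        using order.trans[OF f(2) bound] by (auto simp: abs_le_iff intro!: AE_I2)
           (smt (verit))+
      show "n * f \<mu> \<equiv> \<Sum>i\<in>{1..n}. expectation (\<lambda>\<omega>. f (Z i \<omega>))"
        by (rule eq_reflection) (simp add: Ef)
    qed auto
    \<comment> \<open>Each of the n summands ranges over an interval of length \<open>2 * B\<close>;
      this and the halved threshold produce the constant 8.\<close>
    have "- 2 * (\<epsilon> / 2 * n)\<^sup>2 / (\<Sum>i\<in>{1..n}. (B - - B)\<^sup>2) = - (\<epsilon>\<^sup>2 / (8 * B\<^sup>2)) * n"
      using assms by (simp add: field_simps power2_eq_square)
    then show ?thesis
      using Hoeffding_ineq_abs_ge[of "\<epsilon> / 2 * n"] assms by simp
  qed
  have sub: "{\<omega>\<in>space M. cmod ((\<Sum>j=1..n. Z j \<omega>) / n - \<mu>) \<ge> \<epsilon>} \<subseteq>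
    {\<omega>\<in>space M. \<bar>(\<Sum>j=1..n. Re (Z j \<omega>)) - n * Re \<mu>\<bar> \<ge> \<epsilon> / 2 * n} \<union>
    {\<omega>\<in>space M. \<bar>(\<Sum>j=1..n. Im (Z j \<omega>)) - n * Im \<mu>\<bar> \<ge> \<epsilon> / 2 * n}" (is "_ \<subseteq> ?A \<union> ?B")
  proof
    fix \<omega> assume "\<omega> \<in> {\<omega>\<in>space M. cmod ((\<Sum>j=1..n. Z j \<omega>) / n - \<mu>) \<ge> \<epsilon>}"
    then have \<omega>: "\<omega> \<in> space M" "cmod ((\<Sum>j=1..n. Z j \<omega>) / n - \<mu>) \<ge> \<epsilon>" by auto
    let ?z = "(\<Sum>j=1..n. Z j \<omega>) - n * \<mu>"
    have "?z = ((\<Sum>j=1..n. Z j \<omega>) / n - \<mu>) * n"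
      using \<open>n \<ge> 1\<close> by (simp add: field_simps)
    then have "cmod ?z = cmod ((\<Sum>j=1..n. Z j \<omega>) / n - \<mu>) * n"
      by (simp add: norm_mult)
    then have "\<epsilon> * n \<le> cmod ?z"
      using \<omega>(2) by (simp add: mult_right_mono)
    also have "\<dots> \<le> \<bar>Re ?z\<bar> + \<bar>Im ?z\<bar>" by (rule cmod_le)
    finally have "\<bar>Re ?z\<bar> \<ge> \<epsilon> / 2 * n \<or> \<bar>Im ?z\<bar> \<ge> \<epsilon> / 2 * n"
      by (auto simp: field_simps)
    then show "\<omega> \<in> ?A \<union> ?B" using \<omega>(1) by auto
  qed
  have [measurable]: "?A \<in> events" "?B \<in> events"
    using rv by measurable
  have "prob {\<omega>\<in>space M. cmod ((\<Sum>j=1..n. Z j \<omega>) / n - \<mu>) \<ge> \<epsilon>} \<le> prob (?A \<union> ?B)"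
    by (intro finite_measure_mono sub sets.Un) fact+
  also have "\<dots> \<le> prob ?A + prob ?B"
    by (intro measure_Un_le) fact+
  also have "\<dots> \<le> 4 * exp (- (\<epsilon>\<^sup>2 / (8 * B\<^sup>2)) * n)"
    using *[OF bounded_linear_Re abs_Re_le_cmod] *[OF bounded_linear_Im abs_Im_le_cmod] by simp
  finally show ?thesis .
qed

text \<open>Centring removes exactly the squared norm of the mean. The uncentred second moment of
  the Taylor remainder therefore controls its variance.\<close>

lemma centered_second_moment_le:
  fixes R :: "'a \<Rightarrow> 'b::{euclidean_space}"
  assumes "integrable M R" "integrable M (\<lambda>\<omega>. (norm (R \<omega>))\<^sup>2)"
  shows "integrable M (\<lambda>\<omega>. (norm (R \<omega> - expectation R))\<^sup>2)"
    and "expectation (\<lambda>\<omega>. (norm (R \<omega> - expectation R))\<^sup>2) \<le> expectation (\<lambda>\<omega>. (norm (R \<omega>))\<^sup>2)"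
proof -
  have eq: "(norm (r - expectation R))\<^sup>2 =
      (norm r)\<^sup>2 - 2 * inner r (expectation R) + (norm (expectation R))\<^sup>2" for r
    by (simp add: power2_norm_eq_inner inner_diff inner_commute)
  show "integrable M (\<lambda>\<omega>. (norm (R \<omega> - expectation R))\<^sup>2)"
    unfolding eq using assms by simp
  have "expectation (\<lambda>\<omega>. (norm (R \<omega> - expectation R))\<^sup>2) =
      expectation (\<lambda>\<omega>. (norm (R \<omega>))\<^sup>2) - (norm (expectation R))\<^sup>2"
    unfolding eq using assms by (simp add: prob_space power2_norm_eq_inner)
  then show "expectation (\<lambda>\<omega>. (norm (R \<omega> - expectation R))\<^sup>2) \<le> expectation (\<lambda>\<omega>. (norm (R \<omega>))\<^sup>2)"
    by simp
qed

section \<open>Delta method for the inverse\<close>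

lemma complex_variance_diff_const:
  assumes "integrable M Y"
  shows "complex_variance M (\<lambda>\<omega>. Y \<omega> - c) = complex_variance M Y"
  using assms by (simp add: complex_variance_def complex_expectation_eq_integral prob_space)

text \<open>The linear term \<open>- (W n / \<mu>^2)\<close> carries the whole limit; the remainder
  is negligible in mean square even after multiplication by n. The cubic weight in
  \<open>conc\<close> is the weight n^2 of the Taylor bound times this n. The index 0 is set apart
  because for an empty mean \<open>\<mu> + W 0\<close> vanishes.\<close>

lemma delta_method_inverse:
  fixes W :: "nat \<Rightarrow> 'a \<Rightarrow> complex"
  assumes meas [measurable]: "\<And>n. random_variable borel (W n)"
    and bounded: "\<And>n \<omega>. cmod (W n \<omega>) \<le> B"
    and mean: "\<And>n. n > 0 \<Longrightarrow> expectation (W n) = 0"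
    and second: "\<And>n. n > 0 \<Longrightarrow> n * expectation (\<lambda>\<omega>. (cmod (W n \<omega>))\<^sup>2) = s"
    and conc: "\<And>\<epsilon>. \<epsilon> > 0 \<Longrightarrow>
      (\<lambda>n. real n ^ 3 * prob {\<omega>\<in>space M. cmod (W n \<omega>) \<ge> \<epsilon>}) \<longlonglongrightarrow> 0"
    and \<mu>: "\<mu> \<noteq> 0" and nz: "\<And>n \<omega>. n > 0 \<Longrightarrow> \<mu> + W n \<omega> \<noteq> 0"
    and inv: "\<forall>\<^sub>F n in sequentially. integrable M (\<lambda>\<omega>. cmod (1 / (\<mu> + W n \<omega>)) ^ 4) \<and>
      expectation (\<lambda>\<omega>. cmod (1 / (\<mu> + W n \<omega>)) ^ 4) \<le> K"
  shows "(\<lambda>n. of_nat n * complex_variance M (\<lambda>\<omega>. 1 / (\<mu> + W n \<omega>))) \<longlonglongrightarrow>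
    ennreal (s / cmod \<mu> ^ 4)"
proof -
  define V where "V n \<omega> = 1 / (\<mu> + W n \<omega>)" for n \<omega>
  define R where "R n \<omega> = V n \<omega> - 1 / \<mu> + W n \<omega> / \<mu>\<^sup>2" for n \<omega>
  define v where "v n = expectation (\<lambda>\<omega>. (cmod (V n \<omega> - expectation (V n)))\<^sup>2)" for n
  have [measurable]: "random_variable borel (V n)" "random_variable borel (R n)" for n
    by (simp_all add: V_def[abs_def] R_def[abs_def])
  have intW: "integrable M (W n)" for n
    by (rule integrable_const_bound[of _ B]) (auto simp: bounded)
  have "(cmod (W n \<omega>))\<^sup>2 \<le> B\<^sup>2" for n \<omega>
    by (intro power_mono bounded) auto
  then have intW2: "integrable M (\<lambda>\<omega>. (cmod (W n \<omega>))\<^sup>2)" for n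
    by (intro integrable_const_bound[of _ "B\<^sup>2"]) auto
  have "\<forall>\<^sub>F n in sequentially. n > 0 \<and> integrable M (\<lambda>\<omega>. cmod (V n \<omega>) ^ 4) \<and>
      expectation (\<lambda>\<omega>. cmod (V n \<omega>) ^ 4) \<le> K"
    using inv eventually_gt_at_top[of 0] by eventually_elim (simp add: V_def)
  then have ev: "\<forall>\<^sub>F n in sequentially. n > 0 \<and>
      integrable M (\<lambda>\<omega>. cmod (V n \<omega>) ^ 4) \<and> expectation (\<lambda>\<omega>. cmod (V n \<omega>) ^ 4) \<le> K \<and>
      integrable M (V n) \<and> integrable M (\<lambda>\<omega>. (cmod (V n \<omega>))\<^sup>2) \<and>
      integrable M (R n) \<and> integrable M (\<lambda>\<omega>. (cmod (R n \<omega>))\<^sup>2)"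
  \<comment> \<open>On a probability space the fourth moment of \<open>V n\<close> yields the second
    and the first.\<close>
  proof eventually_elim
    case (elim n)
    then have V4: "integrable M (\<lambda>\<omega>. ((cmod (V n \<omega>))\<^sup>2)\<^sup>2)" by simp
    have V2: "integrable M (\<lambda>\<omega>. (cmod (V n \<omega>))\<^sup>2)"
      by (rule square_integrable_imp_integrable[OF _ V4]) simp
    have "integrable M (\<lambda>\<omega>. cmod (V n \<omega>))"
      by (rule square_integrable_imp_integrable[OF _ V2]) simp
    then have V1: "integrable M (V n)"
      by (subst (asm) integrable_norm_iff) auto
    have R2: "integrable M (\<lambda>\<omega>. (cmod (R n \<omega>))\<^sup>2)"
    proof (rule Bochner_Integration.integrable_bound)
      \<comment> \<open>Integrability alone is at stake, so \<epsilon> is the largest admissible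
        radius and the indicator is replaced by 1.\<close>
      let ?g = "\<lambda>\<omega>. 4 * (cmod \<mu> / 2)\<^sup>2 / cmod \<mu> ^ 6 * (cmod (W n \<omega>))\<^sup>2 +
        B ^ 4 / cmod \<mu> ^ 4 * (cmod (V n \<omega>) ^ 4 / n\<^sup>2 + n\<^sup>2 * 1)"
      show "integrable M ?g" using intW2 elim by simp
      have "(cmod (R n \<omega>))\<^sup>2 \<le> ?g \<omega>" for \<omega>
        unfolding R_def V_def
        by (rule order.trans[OF inverse_Taylor_remainder_bound[of \<mu> "W n \<omega>" B "cmod \<mu> / 2" n]])
          (use \<mu> nz bounded elim in \<open>auto intro!: add_left_mono mult_left_mono simp del: times_divide_eq_left times_divide_eq_right\<close>)
      then show "AE \<omega> in M. norm ((cmod (R n \<omega>))\<^sup>2) \<le> norm (?g \<omega>)"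
        by (intro AE_I2) (smt (verit) real_norm_def zero_le_power2)
    qed simp
    show ?case
      using elim V1 V2 R2 intW by (simp add: R_def[abs_def])
  qed
  have R: "(\<lambda>n. n * expectation (\<lambda>\<omega>. (cmod (R n \<omega>))\<^sup>2)) \<longlonglongrightarrow> 0"
  proof (rule tendsto_zero_of_family_bound)
    let ?A = "\<lambda>\<epsilon> n. {\<omega>\<in>space M. cmod (W n \<omega>) \<ge> \<epsilon>}"
    \<comment> \<open>This is n times the expected Taylor bound, using that n times the second
      moment of \<open>W n\<close> is s. For fixed \<epsilon> the bracket vanishes as n grows; the
      first term goes with \<epsilon>.\<close>
    let ?u = "\<lambda>\<epsilon> n. 4 * \<epsilon>\<^sup>2 / cmod \<mu> ^ 6 * s +
      B ^ 4 / cmod \<mu> ^ 4 * (K / real n + real n ^ 3 * prob (?A \<epsilon> n))"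
    show "?u \<epsilon> \<longlonglongrightarrow> 4 * \<epsilon>\<^sup>2 / cmod \<mu> ^ 6 * s + B ^ 4 / cmod \<mu> ^ 4 * (0 + 0)" if "\<epsilon> > 0" for \<epsilon>
      using that by (intro tendsto_intros conc lim_const_over_n)
    show "((\<lambda>\<epsilon>. 4 * \<epsilon>\<^sup>2 / cmod \<mu> ^ 6 * s + B ^ 4 / cmod \<mu> ^ 4 * (0 + 0)) \<longlongrightarrow> 0) (at_right 0)"
      using \<mu> by (auto intro!: tendsto_eq_intros)
    have "\<forall>\<^sub>F \<epsilon> in at_right 0. \<epsilon> \<in> {0<..<cmod \<mu> / 2}"
      using \<mu> by (intro eventually_at_right_real) simp
    then show "\<forall>\<^sub>F \<epsilon> in at_right 0. \<forall>\<^sub>F n in sequentially.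
      \<bar>n * expectation (\<lambda>\<omega>. (cmod (R n \<omega>))\<^sup>2)\<bar> \<le> ?u \<epsilon> n"
    proof eventually_elim
      case (elim \<epsilon>)
      from ev show ?case
      proof eventually_elim
        case (elim n)
        note n = this
        let ?g = "\<lambda>\<omega>. 4 * \<epsilon>\<^sup>2 / cmod \<mu> ^ 6 * (cmod (W n \<omega>))\<^sup>2 +
          B ^ 4 / cmod \<mu> ^ 4 * (cmod (V n \<omega>) ^ 4 / n\<^sup>2 + n\<^sup>2 * indicat_real (?A \<epsilon> n) \<omega>)"
        have ind: "integrable M (indicat_real (?A \<epsilon> n))"
          by (intro integrable_real_indicator) (auto simp: less_top[symmetric])
        then have g: "integrable M ?g" using intW2 n by simp
        have "expectation (\<lambda>\<omega>. (cmod (R n \<omega>))\<^sup>2) \<le> expectation ?g"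
        proof (rule integral_mono)
          show "(cmod (R n \<omega>))\<^sup>2 \<le> ?g \<omega>" if "\<omega> \<in> space M" for \<omega>
            using inverse_Taylor_remainder_bound[of \<mu> "W n \<omega>" B \<epsilon> n]
              \<open>\<epsilon> \<in> _\<close> \<mu> nz[of n \<omega>] bounded n that
            by (simp add: R_def V_def indicator_def)
        qed (use n g in auto)
        also have "expectation ?g = 4 * \<epsilon>\<^sup>2 / cmod \<mu> ^ 6 * expectation (\<lambda>\<omega>. (cmod (W n \<omega>))\<^sup>2) +
          B ^ 4 / cmod \<mu> ^ 4 * (expectation (\<lambda>\<omega>. cmod (V n \<omega>) ^ 4) / n\<^sup>2 + n\<^sup>2 * prob (?A \<epsilon> n))"
          using intW2 n ind by (simp del: times_divide_eq_left times_divide_eq_right)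
        also have "\<dots> \<le> 4 * \<epsilon>\<^sup>2 / cmod \<mu> ^ 6 * expectation (\<lambda>\<omega>. (cmod (W n \<omega>))\<^sup>2) +
          B ^ 4 / cmod \<mu> ^ 4 * (K / n\<^sup>2 + n\<^sup>2 * prob (?A \<epsilon> n))"
          using n by (intro add_mono mult_left_mono divide_right_mono) auto
        finally have "n * expectation (\<lambda>\<omega>. (cmod (R n \<omega>))\<^sup>2) \<le> n * \<dots>"
          by (rule mult_left_mono) simp
        also have "\<dots> = 4 * \<epsilon>\<^sup>2 / cmod \<mu> ^ 6 * (n * expectation (\<lambda>\<omega>. (cmod (W n \<omega>))\<^sup>2)) +
          B ^ 4 / cmod \<mu> ^ 4 * (K / n + real n ^ 3 * prob (?A \<epsilon> n))"
          using n \<mu> by (simp add: field_simps power2_eq_square power3_eq_cube)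
        also have "\<dots> = ?u \<epsilon> n"
          using second[of n] n by simp
        finally show ?case
          by (simp add: abs_of_nonneg)
      qed
    qed
  qed
  have "(\<lambda>n. n * v n - s / cmod \<mu> ^ 4) \<longlonglongrightarrow> 0"
  proof (rule tendsto_zero_of_family_bound)
    \<comment> \<open>The parameter is now the weight of the cross-term estimate: for fixed \<eta>
      the remainder dies out in n, leaving \<eta> times the target value.\<close>
    let ?u = "\<lambda>\<eta> n. \<eta> * (s / cmod \<mu> ^ 4) +
      (1 + 1 / \<eta>) * (n * expectation (\<lambda>\<omega>. (cmod (R n \<omega>))\<^sup>2))"
    show "?u \<eta> \<longlonglongrightarrow> \<eta> * (s / cmod \<mu> ^ 4) + (1 + 1 / \<eta>) * 0" for \<eta>
      by (intro tendsto_intros R)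
    show "((\<lambda>\<eta>. \<eta> * (s / cmod \<mu> ^ 4) + (1 + 1 / \<eta>) * 0) \<longlongrightarrow> 0) (at_right 0)"
      using \<mu> by (auto intro!: tendsto_eq_intros)
    show "\<forall>\<^sub>F \<eta> in at_right 0. \<forall>\<^sub>F n in sequentially. \<bar>n * v n - s / cmod \<mu> ^ 4\<bar> \<le> ?u \<eta> n"
      using eventually_at_right_less[of 0]
    proof eventually_elim
      case (elim \<eta>)
      from ev show ?case
      proof eventually_elim
        case (elim n)
        note n = this
        \<comment> \<open>The linear term and the centred remainder. They add up to the centred
          \<open>V n\<close> because \<open>W n\<close> has mean zero.\<close>
        let ?a = "\<lambda>\<omega>. - (W n \<omega> / \<mu>\<^sup>2)" and ?b = "\<lambda>\<omega>. R n \<omega> - expectation (R n)"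
        have b: "integrable M (\<lambda>\<omega>. (cmod (?b \<omega>))\<^sup>2)"
          "expectation (\<lambda>\<omega>. (cmod (?b \<omega>))\<^sup>2) \<le> expectation (\<lambda>\<omega>. (cmod (R n \<omega>))\<^sup>2)"
          using centered_second_moment_le[of "R n"] n by auto
        have a2: "(cmod (?a \<omega>))\<^sup>2 = (cmod (W n \<omega>))\<^sup>2 / cmod \<mu> ^ 4" for \<omega>
          by (simp add: norm_divide norm_power power_divide)
        have a: "integrable M (\<lambda>\<omega>. (cmod (?a \<omega>))\<^sup>2)"
          "n * expectation (\<lambda>\<omega>. (cmod (?a \<omega>))\<^sup>2) = s / cmod \<mu> ^ 4"
          using intW2[of n] second[of n] n unfolding a2 by simp_all
        have "expectation (R n) = expectation (V n) - 1 / \<mu>"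
          using n intW[of n] mean[of n] by (simp add: R_def[abs_def] prob_space)
        then have ab: "V n \<omega> - expectation (V n) = ?a \<omega> + ?b \<omega>" for \<omega>
          by (simp add: R_def)
        have "integrable M (\<lambda>\<omega>. (cmod (V n \<omega> - expectation (V n)))\<^sup>2)"
          using n by (intro square_integrable_shift) auto
        then have int_ab: "integrable M (\<lambda>\<omega>. (cmod (?a \<omega> + ?b \<omega>))\<^sup>2)"
          by (simp only: ab)
        have "\<bar>v n - expectation (\<lambda>\<omega>. (cmod (?a \<omega>))\<^sup>2)\<bar> =
            \<bar>expectation (\<lambda>\<omega>. (cmod (?a \<omega> + ?b \<omega>))\<^sup>2 - (cmod (?a \<omega>))\<^sup>2)\<bar>"
          unfolding v_def ab using int_ab a(1) by (subst Bochner_Integration.integral_diff) auto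
        also have "\<dots> \<le> expectation (\<lambda>\<omega>. \<bar>(cmod (?a \<omega> + ?b \<omega>))\<^sup>2 - (cmod (?a \<omega>))\<^sup>2\<bar>)"
          by (rule integral_abs_bound)
        also have "\<dots> \<le> expectation (\<lambda>\<omega>. \<eta> * (cmod (?a \<omega>))\<^sup>2 + (1 + 1 / \<eta>) * (cmod (?b \<omega>))\<^sup>2)"
          using int_ab a(1) b(1) \<open>0 < \<eta>\<close>
          by (intro integral_mono abs_norm_add_square_diff_le Bochner_Integration.integrable_add
              integrable_abs Bochner_Integration.integrable_diff integrable_mult_right) auto
        also have "\<dots> = \<eta> * expectation (\<lambda>\<omega>. (cmod (?a \<omega>))\<^sup>2) +
            (1 + 1 / \<eta>) * expectation (\<lambda>\<omega>. (cmod (?b \<omega>))\<^sup>2)"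
          using a(1) b(1)
          by (subst Bochner_Integration.integral_add) (auto simp del: norm_minus_cancel)
        also have "\<dots> \<le> \<eta> * expectation (\<lambda>\<omega>. (cmod (?a \<omega>))\<^sup>2) +
            (1 + 1 / \<eta>) * expectation (\<lambda>\<omega>. (cmod (R n \<omega>))\<^sup>2)"
          using b(2) \<open>0 < \<eta>\<close> by (intro add_left_mono mult_left_mono) auto
        finally have "n * \<bar>v n - expectation (\<lambda>\<omega>. (cmod (?a \<omega>))\<^sup>2)\<bar> \<le> n * \<dots>"
          by (rule mult_left_mono) simp
        also have "\<dots> = ?u \<eta> n"
          unfolding a(2)[symmetric] by (simp only: distrib_left mult_ac)
        also have "n * \<bar>v n - expectation (\<lambda>\<omega>. (cmod (?a \<omega>))\<^sup>2)\<bar> = \<bar>n * v n - s / cmod \<mu> ^ 4\<bar>"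
          unfolding a(2)[symmetric] by (simp only: abs_mult abs_of_nat flip: right_diff_distrib)
        finally show ?case .
      qed
    qed
  qed
  then have "(\<lambda>n. n * v n) \<longlonglongrightarrow> s / cmod \<mu> ^ 4"
    by (simp add: LIM_zero_iff)
  then have "(\<lambda>n. ennreal (n * v n)) \<longlonglongrightarrow> ennreal (s / cmod \<mu> ^ 4)"
    by (rule tendsto_ennrealI)
  \<comment> \<open>For small n the variance may be infinite while \<open>v n\<close> is real, so
    the two are compared only where square-integrability is known.\<close>
  moreover have "\<forall>\<^sub>F n in sequentially. ennreal (n * v n) = of_nat n * complex_variance M (V n)"
    using ev
  proof eventually_elim
    case (elim n)
    then have "complex_variance M (V n) = ennreal (v n)"
      by (simp add: complex_variance_eq_integral complex_expectation_eq_integral v_def)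
    then show ?case
      by (simp add: ennreal_mult' v_def ennreal_of_nat_eq_real_of_nat)
  qed
  ultimately show ?thesis
    unfolding V_def by (rule Lim_transform_eventually)
qed

end

theorem theorem3p1:
  fixes M :: "'a measure"
    and X :: "nat \<Rightarrow> 'a \<Rightarrow> real"
    and \<alpha> :: complex
    and \<beta> :: real
  assumes "prob_space M"
    and "\<alpha> \<in> upper_half_plane"
    and "prob_space.indep_vars M (\<lambda>_. borel) X {1..}"
    and "\<And>i. i \<ge> 1 \<Longrightarrow> distr M borel (X i) = distr M borel (X 1)"
    and "\<And>i x. i \<ge> 1 \<Longrightarrow> measure M {\<omega> \<in> space M. X i \<omega> = x} = 0"
    and "\<beta> > 0"
    and "integrable M (\<lambda>\<omega>. \<bar>X 1 \<omega>\<bar> powr \<beta>)"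
  shows "(\<lambda>n. of_nat n * complex_variance M (C_stat \<alpha> X n)) \<longlonglongrightarrow>
    ennreal (1 / (cmod (complex_expectation M (\<lambda>\<omega>. 1 / (complex_of_real (X 1 \<omega>) + \<alpha>)))) ^ 4) *
    complex_variance M (\<lambda>\<omega>. 1 / (complex_of_real (X 1 \<omega>) + \<alpha>))"
proof -

  \<comment> \<open>The bounded variables \<open>Z i\<close> and their mean\<close>
  interpret prob_space M by fact
  define Z where "Z i \<omega> = 1 / (complex_of_real (X i \<omega>) + \<alpha>)" for i \<omega>
  define \<mu> where "\<mu> = expectation (Z 1)"
  define B where "B = 1 / Im \<alpha>"
  define W where "W n \<omega> = (\<Sum>j=1..n. Z j \<omega>) / n - \<mu>" for n \<omega>
  define s where "s = expectation (\<lambda>\<omega>. (cmod (Z 1 \<omega> - \<mu>))\<^sup>2)"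
  have \<alpha>: "Im \<alpha> > 0" using assms(2) by (simp add: upper_half_plane_def)
  have B: "B > 0" using \<alpha> by (simp add: B_def)
  have rvX [measurable]: "random_variable borel (X i)" if "i \<ge> 1" for i
    using assms(3) that by (auto simp: indep_vars_def)
  have rvZ: "random_variable borel (Z i)" if "i \<ge> 1" for i
    unfolding Z_def[abs_def] using rvX[OF that] by measurable
  \<comment> \<open>The sign of the imaginary part is the same for every i and \<omega>. Hence sums
    of the \<open>Z i\<close> cannot cancel to 0, and \<open>- Im (Z i \<omega>)\<close> is a
    positive real variable to which the inverse moment bound applies.\<close>
  have ImZ: "- Im (Z i \<omega>) = Im \<alpha> / (cmod (complex_of_real (X i \<omega>) + \<alpha>))\<^sup>2" for i \<omega>
    by (simp add: Z_def Im_divide cmod_power2)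
  have nzX: "complex_of_real (X i \<omega>) + \<alpha> \<noteq> 0" for i \<omega>
    using \<alpha> by (auto simp: complex_eq_iff)
  have ImZ_pos: "- Im (Z i \<omega>) > 0" for i \<omega>
    unfolding ImZ using \<alpha> nzX by simp
  have Z_le: "cmod (Z i \<omega>) \<le> B" for i \<omega>
  proof -
    have "Im \<alpha> \<le> cmod (complex_of_real (X i \<omega>) + \<alpha>)"
      using abs_Im_le_cmod[of "complex_of_real (X i \<omega>) + \<alpha>"] by simp
    then show ?thesis
      using \<alpha> by (simp add: Z_def B_def norm_divide frac_le)
  qed
  have intZ: "integrable M (Z i)" if "i \<ge> 1" for i
    by (rule integrable_const_bound[of _ B]) (use rvZ that Z_le in auto)
  have indepZ: "indep_vars (\<lambda>_. borel) Z {1..}"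
    unfolding Z_def[abs_def] by (rule indep_vars_compose2[OF assms(3)]) measurable
  have cong_Z: "expectation (\<lambda>\<omega>. h (Z i \<omega>)) = expectation (\<lambda>\<omega>. h (Z 1 \<omega>))"
    if "i \<ge> 1" and [measurable]: "h \<in> borel_measurable borel"
    for i and h :: "complex \<Rightarrow> 'b::{banach, second_countable_topology}"
    unfolding Z_def
    by (rule expectation_cong_distr[OF assms(4)[OF that(1)] rvX[OF that(1)] rvX[OF order_refl],
          of "\<lambda>x. h (1 / (complex_of_real x + \<alpha>))"]) measurable
  have meanZ: "expectation (Z i) = \<mu>" if "i \<ge> 1" for i
    using cong_Z[OF that, of "\<lambda>z. z"] by (simp add: \<mu>_def)
  \<comment> \<open>\<open>- Im \<mu>\<close> is the expectation of a strictly positive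
    variable.\<close>
  have \<mu>: "\<mu> \<noteq> 0"
  proof
    assume "\<mu> = 0"
    have int: "integrable M (\<lambda>\<omega>. - Im (Z 1 \<omega>))"
      using intZ[of 1] by auto
    have "expectation (\<lambda>\<omega>. - Im (Z 1 \<omega>)) = - Im \<mu>"
      using intZ[of 1] by (simp add: \<mu>_def)
    then have "AE \<omega> in M. - Im (Z 1 \<omega>) = 0"
      using integral_nonneg_eq_0_iff_AE[OF int] ImZ_pos \<open>\<mu> = 0\<close> by (simp add: less_imp_le)
    then have "AE \<omega> in M. False"
      by eventually_elim (use ImZ_pos in \<open>metis less_irrefl\<close>)
    then show False by simp
  qed

  \<comment> \<open>Second moment and concentration of the centred means\<close>
  have rvW [measurable]: "random_variable borel (W n)" for n
    unfolding W_def[abs_def] using rvZ by measurable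
  have W_le: "cmod (W n \<omega>) \<le> 2 * B" for n \<omega>
  proof -
    have "cmod \<mu> \<le> expectation (\<lambda>\<omega>. cmod (Z 1 \<omega>))"
      unfolding \<mu>_def by (rule integral_norm_bound)
    also have "\<dots> \<le> B"
      using intZ[of 1] Z_le by (intro integral_le_const) auto
    finally have "cmod \<mu> \<le> B" .
    moreover have "cmod ((\<Sum>j=1..n. Z j \<omega>) / n) \<le> B"
    \<comment> \<open>For n = 0 the quotient is 0 by the convention for division by zero.\<close>
    proof (cases "n = 0")
      case False
      have "cmod (\<Sum>j=1..n. Z j \<omega>) \<le> (\<Sum>j=1..n. B)"
        by (intro sum_norm_le Z_le)
      with False show ?thesis by (simp add: norm_divide field_simps)
    qed (use B in simp)
    ultimately show ?thesis
      unfolding W_def using norm_triangle_ineq4[of "(\<Sum>j=1..n. Z j \<omega>) / n" \<mu>] by linarith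
  qed
  have second: "n * expectation (\<lambda>\<omega>. (cmod (W n \<omega>))\<^sup>2) = s" if "n > 0" for n
  proof -
    \<comment> \<open>The real identity for sums of squares is applied to \<open>Re\<close> and
      \<open>Im\<close> separately; \<open>cmod_power2\<close> recombines them.\<close>
    have *: "integrable M (\<lambda>\<omega>. (f (Z 1 \<omega> - \<mu>))\<^sup>2) \<and>
        integrable M (\<lambda>\<omega>. (\<Sum>j=1..n. f (Z j \<omega> - \<mu>))\<^sup>2) \<and>
        expectation (\<lambda>\<omega>. (\<Sum>j=1..n. f (Z j \<omega> - \<mu>))\<^sup>2) =
        n * expectation (\<lambda>\<omega>. (f (Z 1 \<omega> - \<mu>))\<^sup>2)"
      if f: "bounded_linear f" "\<And>z. \<bar>f z\<bar> \<le> cmod z" for f :: "complex \<Rightarrow> real"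
    proof -
      have [measurable]: "f \<in> borel_measurable borel"
        by (intro borel_measurable_continuous_onI linear_continuous_on f)
      have sq: "integrable M (\<lambda>\<omega>. (f (Z i \<omega> - \<mu>))\<^sup>2)" if "i \<ge> 1" for i
      proof (rule integrable_const_bound)
        have "\<bar>f (Z i \<omega> - \<mu>)\<bar> \<le> B + cmod \<mu>" for \<omega>
          using f(2)[of "Z i \<omega> - \<mu>"] norm_triangle_ineq4[of "Z i \<omega>" \<mu>] Z_le[of i \<omega>] by linarith
        then have "\<bar>f (Z i \<omega> - \<mu>)\<bar>\<^sup>2 \<le> (B + cmod \<mu>)\<^sup>2" for \<omega>
          by (rule power_mono) simp
        then show "AE \<omega> in M. norm ((f (Z i \<omega> - \<mu>))\<^sup>2) \<le> (B + cmod \<mu>)\<^sup>2"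
          by simp
      qed (use rvZ[OF that] in measurable)
      have zero: "expectation (\<lambda>\<omega>. f (Z i \<omega> - \<mu>)) = 0" if "i \<ge> 1" for i
        using integral_bounded_linear[OF f(1), of M "\<lambda>\<omega>. Z i \<omega> - \<mu>"] intZ[OF that] meanZ[OF that]
          linear_0[OF bounded_linear.linear[OF f(1)]]
        by (simp add: prob_space)
      have "indep_vars (\<lambda>_. borel) (\<lambda>i \<omega>. f (Z i \<omega> - \<mu>)) {1..n}"
        by (rule indep_vars_compose2[OF indep_vars_subset[OF indepZ]]) auto
      then have sum: "integrable M (\<lambda>\<omega>. (\<Sum>j=1..n. f (Z j \<omega> - \<mu>))\<^sup>2) \<and>
          expectation (\<lambda>\<omega>. (\<Sum>j=1..n. f (Z j \<omega> - \<mu>))\<^sup>2) =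
          (\<Sum>j=1..n. expectation (\<lambda>\<omega>. (f (Z j \<omega> - \<mu>))\<^sup>2))"
        by (rule indep_vars_expectation_sum_square[OF finite_atLeastAtMost]) (auto intro!: sq zero)
      have "(\<Sum>j=1..n. expectation (\<lambda>\<omega>. (f (Z j \<omega> - \<mu>))\<^sup>2)) =
          (\<Sum>j=1..n. expectation (\<lambda>\<omega>. (f (Z 1 \<omega> - \<mu>))\<^sup>2))"
        by (intro sum.cong refl cong_Z[of _ "\<lambda>z. (f (z - \<mu>))\<^sup>2"]) auto
      with sum sq[of 1] show ?thesis
        by simp
    qed
    have W_eq: "W n \<omega> = (\<Sum>j=1..n. Z j \<omega> - \<mu>) / n" for \<omega>
      using that by (simp add: W_def sum_subtractf field_simps)
    have "(cmod (W n \<omega>))\<^sup>2 = ((\<Sum>j=1..n. Re (Z j \<omega> - \<mu>))\<^sup>2 + (\<Sum>j=1..n. Im (Z j \<omega> - \<mu>))\<^sup>2) / n\<^sup>2"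
      for \<omega>
      unfolding W_eq norm_divide power_divide cmod_power2 Re_sum Im_sum by simp
    moreover note * = *[OF bounded_linear_Re abs_Re_le_cmod] *[OF bounded_linear_Im abs_Im_le_cmod]
    ultimately have "expectation (\<lambda>\<omega>. (cmod (W n \<omega>))\<^sup>2) =
        (n * expectation (\<lambda>\<omega>. (Re (Z 1 \<omega> - \<mu>))\<^sup>2) + n * expectation (\<lambda>\<omega>. (Im (Z 1 \<omega> - \<mu>))\<^sup>2)) / n\<^sup>2"
      by (simp del: minus_complex.sel)
    moreover have "s = expectation (\<lambda>\<omega>. (Re (Z 1 \<omega> - \<mu>))\<^sup>2) + expectation (\<lambda>\<omega>. (Im (Z 1 \<omega> - \<mu>))\<^sup>2)"
      unfolding s_def cmod_power2 using * by (subst Bochner_Integration.integral_add) blast+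
    ultimately have "expectation (\<lambda>\<omega>. (cmod (W n \<omega>))\<^sup>2) = n * s / n\<^sup>2"
      by (simp only: distrib_left)
    then show ?thesis
      using that by (simp add: power2_eq_square)
  qed
  have conc: "(\<lambda>n. real n ^ 3 * prob {\<omega>\<in>space M. cmod (W n \<omega>) \<ge> \<epsilon>}) \<longlonglongrightarrow> 0" if "\<epsilon> > 0" for \<epsilon>
  proof (rule tendsto_sandwich[OF _ _ tendsto_const])
    define c where "c = \<epsilon>\<^sup>2 / (8 * B\<^sup>2)"
    have "c > 0" using that B by (simp add: c_def)
    \<comment> \<open>The exponential Hoeffding bound absorbs the cubic weight.\<close>
    then show "(\<lambda>n. real n ^ 3 * (4 * exp (- c * real n))) \<longlonglongrightarrow> 0"
      by real_asymp
    show "\<forall>\<^sub>F n in sequentially. real n ^ 3 * prob {\<omega>\<in>space M. cmod (W n \<omega>) \<ge> \<epsilon>} \<le>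
        real n ^ 3 * (4 * exp (- c * real n))"
      using eventually_ge_at_top[of 1]
    proof eventually_elim
      case (elim n)
      show ?case
        unfolding W_def c_def
        by (intro mult_left_mono Hoeffding_mean_complex[OF indepZ meanZ Z_le B that elim]) auto
    qed
  qed auto

  \<comment> \<open>Uniform bound on the inverse fourth moment\<close>
  have V_eq: "\<mu> + W n \<omega> = (\<Sum>j=1..n. Z j \<omega>) / n" for n \<omega>
    by (simp add: W_def)
  have Y_pos: "(\<Sum>j=1..n. - Im (Z j \<omega>)) > 0" if "n > 0" for n \<omega>
    using that ImZ_pos by (intro sum_pos) auto
  have V_le: "cmod (1 / (\<mu> + W n \<omega>)) ^ 4 \<le> (n / (\<Sum>j=1..n. - Im (Z j \<omega>))) powr 4" if "n > 0" for n \<omega>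
  proof -
    have "(\<Sum>j=1..n. - Im (Z j \<omega>)) \<le> cmod (\<Sum>j=1..n. Z j \<omega>)"
      using abs_Im_le_cmod[of "\<Sum>j=1..n. Z j \<omega>"] by (simp add: sum_negf)
    then have "cmod (1 / (\<mu> + W n \<omega>)) \<le> n / (\<Sum>j=1..n. - Im (Z j \<omega>))"
      unfolding V_eq using Y_pos[OF that, of \<omega>] by (simp add: norm_divide frac_le del: sum_negf)
    then have "cmod (1 / (\<mu> + W n \<omega>)) ^ 4 \<le> (n / (\<Sum>j=1..n. - Im (Z j \<omega>))) ^ 4"
      by (rule power_mono) simp
    also have "\<dots> = (n / (\<Sum>j=1..n. - Im (Z j \<omega>))) powr 4"
      using that Y_pos[OF that, of \<omega>] by (subst powr_numeral) auto
    finally show ?thesis .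
  qed
  have "\<exists>K. \<forall>\<^sub>F n in sequentially.
    integrable M (\<lambda>\<omega>. (n / (\<Sum>j=1..n. - Im (Z j \<omega>))) powr 4) \<and>
    expectation (\<lambda>\<omega>. (n / (\<Sum>j=1..n. - Im (Z j \<omega>))) powr 4) \<le> K"
  proof (rule inverse_mean_moment_bound)
    show "indep_vars (\<lambda>_. borel) (\<lambda>i \<omega>. - Im (Z i \<omega>)) {1..}"
      by (rule indep_vars_compose2[OF indepZ]) measurable
    show "distr M borel (\<lambda>\<omega>. - Im (Z i \<omega>)) = distr M borel (\<lambda>\<omega>. - Im (Z 1 \<omega>))" if "i \<ge> 1" for i
    proof -
      have g: "(\<lambda>x. - Im (1 / (complex_of_real x + \<alpha>))) \<in> borel_measurable borel"
        by measurable
      show ?thesis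
        using assms(4)[OF that] distr_distr[OF g rvX[OF that]] distr_distr[OF g rvX[OF order_refl]]
        by (simp add: Z_def comp_def)
    qed
    \<comment> \<open>The order is \<beta> / 2 because \<open>- Im (Z 1 \<omega>)\<close> is
      \<open>Im \<alpha>\<close> over the squared modulus of X + \<alpha>; its power of order
      -\<beta> / 2 is thus a multiple of the power \<beta> of that modulus.\<close>
    show "integrable M (\<lambda>\<omega>. (- Im (Z 1 \<omega>)) powr (- (\<beta> / 2)))"
    proof (rule Bochner_Integration.integrable_bound)
      let ?g = "\<lambda>\<omega>. Im \<alpha> powr (- (\<beta> / 2)) * (2 powr \<beta> * (\<bar>X 1 \<omega>\<bar> powr \<beta> + cmod \<alpha> powr \<beta>))"
      show "integrable M ?g" using assms(7) by simp
      show "(\<lambda>\<omega>. (- Im (Z 1 \<omega>)) powr (- (\<beta> / 2))) \<in> borel_measurable M"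
        using rvZ[of 1] by measurable
      have "(- Im (Z 1 \<omega>)) powr (- (\<beta> / 2)) \<le> ?g \<omega>" for \<omega>
      proof -
        let ?r = "cmod (complex_of_real (X 1 \<omega>) + \<alpha>)"
        have r: "?r > 0" using nzX by simp
        have "(- Im (Z 1 \<omega>)) powr (- (\<beta> / 2)) = Im \<alpha> powr (- (\<beta> / 2)) * ?r powr \<beta>"
        proof -
          have "?r\<^sup>2 powr (- (\<beta> / 2)) = ?r powr (- \<beta>)"
            using r by (simp add: powr_powr flip: powr_numeral)
          then show ?thesis
            unfolding ImZ using \<alpha> r by (simp add: powr_divide powr_minus divide_simps)
        qed
        \<comment> \<open>Passing through the maximum works for every \<beta> > 0, whether the power
          is concave or convex.\<close>
        also have "?r powr \<beta> \<le> (2 * max \<bar>X 1 \<omega>\<bar> (cmod \<alpha>)) powr \<beta>"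
          using norm_triangle_ineq[of "complex_of_real (X 1 \<omega>)" \<alpha>] assms(6)
          by (intro powr_mono2) auto
        also have "\<dots> = 2 powr \<beta> * max \<bar>X 1 \<omega>\<bar> (cmod \<alpha>) powr \<beta>"
          by (rule powr_mult)
        also have "\<dots> \<le> 2 powr \<beta> * (\<bar>X 1 \<omega>\<bar> powr \<beta> + cmod \<alpha> powr \<beta>)"
          by (intro mult_left_mono) (auto simp: max_def)
        finally show ?thesis
          by (simp add: mult_left_mono)
      qed
      then show "AE \<omega> in M. norm ((- Im (Z 1 \<omega>)) powr (- (\<beta> / 2))) \<le> norm (?g \<omega>)"
        by (intro AE_I2) (smt (verit) powr_ge_zero real_norm_def)
    qed
  qed (use ImZ_pos assms(6) in auto)
  then obtain K where K: "\<forall>\<^sub>F n in sequentially.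
    integrable M (\<lambda>\<omega>. (n / (\<Sum>j=1..n. - Im (Z j \<omega>))) powr 4) \<and>
    expectation (\<lambda>\<omega>. (n / (\<Sum>j=1..n. - Im (Z j \<omega>))) powr 4) \<le> K" by blast
  have inv: "\<forall>\<^sub>F n in sequentially. integrable M (\<lambda>\<omega>. cmod (1 / (\<mu> + W n \<omega>)) ^ 4) \<and>
    expectation (\<lambda>\<omega>. cmod (1 / (\<mu> + W n \<omega>)) ^ 4) \<le> K"
    using K eventually_gt_at_top[of 0]
  proof eventually_elim
    case (elim n)
    have int: "integrable M (\<lambda>\<omega>. cmod (1 / (\<mu> + W n \<omega>)) ^ 4)"
      by (rule Bochner_Integration.integrable_bound[OF conjunct1[OF elim(1)]])
        (use V_le[OF elim(2)] in auto)
    with integral_mono[OF int conjunct1[OF elim(1)] V_le[OF elim(2)]] elim(1) show ?case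
      by linarith
  qed
  have nzV: "\<mu> + W n \<omega> \<noteq> 0" if "n > 0" for n \<omega>
  proof -
    have "Im (\<Sum>j=1..n. Z j \<omega>) \<noteq> 0"
      using Y_pos[OF that, of \<omega>] by (simp add: sum_negf)
    then show ?thesis
      unfolding V_eq using that by (metis divide_eq_0_iff of_nat_eq_0_iff less_irrefl zero_complex.sel(2))
  qed
  have meanW: "expectation (W n) = 0" if "n > 0" for n
  proof -
    have int: "integrable M (\<lambda>\<omega>. \<Sum>j=1..n. Z j \<omega>)"
      using intZ by (intro Bochner_Integration.integrable_sum) auto
    have "expectation (\<lambda>\<omega>. \<Sum>j=1..n. Z j \<omega>) = (\<Sum>j=1..n. expectation (Z j))"
      using intZ by (intro Bochner_Integration.integral_sum) auto
    also have "\<dots> = n * \<mu>"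
      using meanZ by simp
    finally show ?thesis
      using that int by (simp add: W_def[abs_def] prob_space)
  qed

  \<comment> \<open>Transfer to \<open>C_stat\<close> and identification of the limit\<close>
  have "(\<lambda>n. of_nat n * complex_variance M (\<lambda>\<omega>. 1 / (\<mu> + W n \<omega>))) \<longlonglongrightarrow>
      ennreal (s / cmod \<mu> ^ 4)"
    by (rule delta_method_inverse[OF rvW W_le meanW second conc \<mu> nzV inv])
  moreover have "\<forall>\<^sub>F n in sequentially. of_nat n * complex_variance M (\<lambda>\<omega>. 1 / (\<mu> + W n \<omega>)) =
      of_nat n * complex_variance M (C_stat \<alpha> X n)"
    using inv eventually_gt_at_top[of 0]
  proof eventually_elim
    case (elim n)
    have C: "C_stat \<alpha> X n = (\<lambda>\<omega>. 1 / (\<mu> + W n \<omega>) - \<alpha>)"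
    proof
      fix \<omega>
      \<comment> \<open>The numerator is thereby affine in the sum of the \<open>Z j\<close>, so the
        statistic is an inverse mean shifted by the constant -\<alpha>, which the variance
        ignores.\<close>
      have "complex_of_real (X j \<omega>) / (complex_of_real (X j \<omega>) + \<alpha>) = 1 - \<alpha> * Z j \<omega>" for j
        using nzX[of j \<omega>] by (simp add: Z_def field_simps)
      then have "C_stat \<alpha> X n \<omega> = (n - \<alpha> * (\<Sum>j=1..n. Z j \<omega>)) / (\<Sum>j=1..n. Z j \<omega>)"
        by (simp add: C_stat_def Z_def sum_subtractf sum_distrib_left)
      also have "\<dots> = 1 / (\<mu> + W n \<omega>) - \<alpha>"
        using nzV[OF elim(2), of \<omega>] unfolding V_eq by (simp add: diff_divide_distrib)
      finally show "C_stat \<alpha> X n \<omega> = 1 / (\<mu> + W n \<omega>) - \<alpha>" .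
    qed
    \<comment> \<open>Removing the shift requires a first moment, obtained here from the
      fourth.\<close>
    have "integrable M (\<lambda>\<omega>. ((cmod (1 / (\<mu> + W n \<omega>)))\<^sup>2)\<^sup>2)"
      using elim by simp
    then have "integrable M (\<lambda>\<omega>. (cmod (1 / (\<mu> + W n \<omega>)))\<^sup>2)"
      by (rule square_integrable_imp_integrable[rotated]) measurable
    then have "integrable M (\<lambda>\<omega>. cmod (1 / (\<mu> + W n \<omega>)))"
      by (rule square_integrable_imp_integrable[rotated]) measurable
    then have "integrable M (\<lambda>\<omega>. 1 / (\<mu> + W n \<omega>))"
      by (subst (asm) integrable_norm_iff) measurable
    then show ?case
      unfolding C by (simp only: complex_variance_diff_const)
  qed
  ultimately have lim: "(\<lambda>n. of_nat n * complex_variance M (C_stat \<alpha> X n)) \<longlonglongrightarrow>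
      ennreal (s / cmod \<mu> ^ 4)"
    by (rule Lim_transform_eventually)
  have "(cmod (Z 1 \<omega>))\<^sup>2 \<le> B\<^sup>2" for \<omega>
    by (intro power_mono Z_le) simp
  then have "integrable M (\<lambda>\<omega>. (cmod (Z 1 \<omega>))\<^sup>2)"
    using rvZ[of 1] by (intro integrable_const_bound[of _ "B\<^sup>2"]) auto
  then have "complex_variance M (Z 1) = ennreal s"
    using rvZ[of 1] intZ[of 1]
    by (simp add: complex_variance_eq_integral complex_expectation_eq_integral s_def \<mu>_def)
  moreover have "complex_expectation M (Z 1) = \<mu>"
    using intZ[of 1] by (simp add: complex_expectation_eq_integral \<mu>_def)
  ultimately have "ennreal (1 / cmod (complex_expectation M (Z 1)) ^ 4) * complex_variance M (Z 1) =
      ennreal (s / cmod \<mu> ^ 4)"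
    by (simp add: s_def flip: ennreal_mult)
  with lim show ?thesis
    by (simp add: Z_def[abs_def])
qed

end
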